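(* Let $J$ be an $SL(N,\mathbb{C})$-valued solution of the SDYM3 equation $$F[J]\equiv D_{\bar y}(J^{-1}J_y)+D_z(J^{-1}J_z)=0,$$ and let $X$ be an associated potential, i.e. $J^{-1}J_y=X_z$ and $J^{-1}J_z=-X_{\bar y}$, so that $X$ solves the PSDYM3 equation $$G[X]\equiv X_{y\bar y}+X_{zz}+[X_z,X_{\bar y}]=0.$$ If $Q$ is a symmetry characteristic of the SDYM3 equation, then $\Phi=J^{-1}Q$ is a symmetry characteristic of the PSDYM3 equation. Conversely, if $\Phi$ is a symmetry characteristic of the PSDYM3 equation, then $Q=J\Phi$ is a symmetry characteristic of the SDYM3 equation.
   Context: The independent variables are $y,z,\bar y$ (complex, treated as three independent variables). $D_y,D_z,D_{\bar y}$ are the total derivatives, also denoted by subscripts; they commute and satisfy the Leibniz rule. $J$ is $SL(N,\mathbb{C})$-valued, $X$ is $sl(N,\mathbb{C})$-valued, and $[\cdot,\cdot]$ is the matrix commutator. Characteristics $Q$ and $\Phi$ are matrix-valued functions that may depend locally or nonlocally (through integrals) on the independent variables, $J$, $X$ and their derivatives. The Fréchet derivative $\Delta$ with respect to a characteristic is the linear operator that annihilates functions of $y,z,\bar y$ alone, satisfies the Leibniz rule, commutes with all total derivatives, and satisfies $\Delta J=Q$ (respectively $\Delta X=\Phi$). In particular $\Delta(A^{-1})=-A^{-1}(\Delta A)A^{-1}$ for invertible matrix functions $A$. $Q$ is a symmetry characteristic of SDYM3 if, with $\Delta J=Q$, $\Delta F[J]=0$ holds whenever $F[J]=0$. $\Phi$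 is a symmetry characteristic of PSDYM3 if, with $\Delta X=\Phi$, $\Delta G[X]=0$ holds whenever $G[X]=0$. Both conditions are imposed along the related solutions $J$ and $X$. *)

theory Defs
  imports "HOL-Complex_Analysis.Complex_Analysis"
begin

text \<open>
  A field is an \<open>N \<times> N\<close> complex matrix function (\<open>N = CARD('n)\<close>) of the three independent complex
  variables \<open>(y, z, ybar)\<close>. All equations are imposed on an open set \<open>\<Omega>\<close> of these variables;
  values of a field outside \<open>\<Omega>\<close> are irrelevant.
\<close>

type_synonym 'n field = "complex \<times> complex \<times> complex \<Rightarrow> complex ^ 'n ^ 'n"

datatype coord = Y | Z | Ybar

primrec pderiv3 :: "coord \<Rightarrow> (complex \<times> complex \<times> complex \<Rightarrow> complex) \<Rightarrow>
    complex \<times> complex \<times> complex \<Rightarrow> complex" where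
  "pderiv3 Y f = (\<lambda>(y, z, w). deriv (\<lambda>t. f (t, z, w)) y)"
| "pderiv3 Z f = (\<lambda>(y, z, w). deriv (\<lambda>t. f (y, t, w)) z)"
| "pderiv3 Ybar f = (\<lambda>(y, z, w). deriv (\<lambda>t. f (y, z, t)) w)"

text \<open>
  Total derivative. A field is always a quantity already evaluated along given \<open>J\<close> and \<open>X\<close>, so
  that its total derivatives are its (entrywise) complex partial derivatives.
\<close>

definition D :: "coord \<Rightarrow> 'n::finite field \<Rightarrow> 'n field" where
  "D c A = (\<lambda>p. \<chi> i j. pderiv3 c (\<lambda>q. A q $ i $ j) p)"

text \<open>Joint holomorphy: every entry has a complex-linear total derivative at each point.\<close>

definition holo :: "(complex \<times> complex \<times> complex) set \<Rightarrow> 'n::finite field \<Rightarrow> bool" where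
  "holo \<Omega> A \<longleftrightarrow> (\<forall>p\<in>\<Omega>. \<forall>i j. \<exists>a b c.
     ((\<lambda>q. A q $ i $ j) has_derivative (\<lambda>(h, k, l). a * h + b * k + c * l)) (at p))"

text \<open>
  Differential expressions in one dependent variable (\<open>Dep\<close>, standing for \<open>J\<close> or for \<open>X\<close>);
  \<open>Fn f\<close> is a given function of the independent variables alone. The Frechet derivative has to
  see the equation as an expression in the dependent variable: as an operator on functions already
  evaluated on a solution it would annihilate \<open>F[J] = 0\<close> for trivial reasons.
\<close>

datatype (dead 'n::finite) dexpr =
    Fn "'n field"
  | Dep
  | Add "'n dexpr" "'n dexpr"
  | Scale complex "'n dexpr"
  | Mul "'n dexpr" "'n dexpr"
  | Inv "'n dexpr"
  | Der coord "'n dexpr"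

primrec eval :: "'n::finite field \<Rightarrow> 'n dexpr \<Rightarrow> 'n field" where
  "eval u (Fn f) = f"
| "eval u Dep = u"
| "eval u (Add A B) = (\<lambda>p. eval u A p + eval u B p)"
| "eval u (Scale c A) = (\<lambda>p. mat c ** eval u A p)"
| "eval u (Mul A B) = (\<lambda>p. eval u A p ** eval u B p)"
| "eval u (Inv A) = (\<lambda>p. matrix_inv (eval u A p))"
| "eval u (Der c A) = D c (eval u A)"

text \<open>
  \<open>frechet u q A\<close> is \<open>\<Delta>A\<close>, evaluated along \<open>u\<close>, where \<open>\<Delta>\<close> is the Frechet derivative with
  \<open>\<Delta>u = q\<close>: linear, zero on functions of the independent variables, a derivation of the matrix
  product (hence the rule for inverses), and commuting with the total derivatives.
\<close>

primrec frechet :: "'n::finite field \<Rightarrow> 'n field \<Rightarrow> 'n dexpr \<Rightarrow> 'n field" where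
  "frechet u q (Fn f) = (\<lambda>p. 0)"
| "frechet u q Dep = q"
| "frechet u q (Add A B) = (\<lambda>p. frechet u q A p + frechet u q B p)"
| "frechet u q (Scale c A) = (\<lambda>p. mat c ** frechet u q A p)"
| "frechet u q (Mul A B) = (\<lambda>p. frechet u q A p ** eval u B p + eval u A p ** frechet u q B p)"
| "frechet u q (Inv A) =
     (\<lambda>p. - (matrix_inv (eval u A p) ** frechet u q A p ** matrix_inv (eval u A p)))"
| "frechet u q (Der c A) = D c (frechet u q A)"

definition commutator :: "'n::finite dexpr \<Rightarrow> 'n dexpr \<Rightarrow> 'n dexpr" where
  "commutator A B = Add (Mul A B) (Scale (- 1) (Mul B A))"

definition SDYM3 :: "'n::finite dexpr" where
  "SDYM3 = Add (Der Ybar (Mul (Inv Dep) (Der Y Dep))) (Der Z (Mul (Inv Dep) (Der Z Dep)))"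

definition PSDYM3 :: "'n::finite dexpr" where
  "PSDYM3 = Add (Add (Der Ybar (Der Y Dep)) (Der Z (Der Z Dep)))
                (commutator (Der Z Dep) (Der Ybar Dep))"

lemma eval_SDYM3:
  "eval J SDYM3 p =
     D Ybar (\<lambda>q. matrix_inv (J q) ** D Y J q) p + D Z (\<lambda>q. matrix_inv (J q) ** D Z J q) p"
  by (simp add: SDYM3_def)

lemma eval_PSDYM3:
  "eval X PSDYM3 p =
     D Ybar (D Y X) p + D Z (D Z X) p + (D Z X p ** D Ybar X p - D Ybar X p ** D Z X p)"
proof -
  have "mat (- 1) ** A = - A" for A :: "complex ^ 'a ^ 'a"
    by (simp add: vec_eq_iff matrix_matrix_mult_def mat_def if_distrib if_distribR
        cong: if_cong)
  then show ?thesis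
    by (simp add: PSDYM3_def commutator_def)
qed

definition SDYM3_solution ::
    "(complex \<times> complex \<times> complex) set \<Rightarrow> 'n::finite field \<Rightarrow> bool" where
  "SDYM3_solution \<Omega> J \<longleftrightarrow>
     holo \<Omega> J \<and> (\<forall>p\<in>\<Omega>. det (J p) = 1) \<and> (\<forall>p\<in>\<Omega>. eval J SDYM3 p = 0)"

definition PSDYM3_solution ::
    "(complex \<times> complex \<times> complex) set \<Rightarrow> 'n::finite field \<Rightarrow> bool" where
  "PSDYM3_solution \<Omega> X \<longleftrightarrow>
     holo \<Omega> X \<and> (\<forall>p\<in>\<Omega>. trace (X p) = 0) \<and> (\<forall>p\<in>\<Omega>. eval X PSDYM3 p = 0)"

definition potential ::
    "(complex \<times> complex \<times> complex) set \<Rightarrow> 'n::finite field \<Rightarrow> 'n field \<Rightarrow> bool" where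
  "potential \<Omega> J X \<longleftrightarrow>
     holo \<Omega> X \<and> (\<forall>p\<in>\<Omega>. trace (X p) = 0) \<and>
     (\<forall>p\<in>\<Omega>. matrix_inv (J p) ** D Y J p = D Z X p) \<and>
     (\<forall>p\<in>\<Omega>. matrix_inv (J p) ** D Z J p = - D Ybar X p)"

text \<open>
  A characteristic may depend on \<open>J\<close> and \<open>X\<close> in any way, local or nonlocal, and is therefore an
  arbitrary map from pairs \<open>(J, X)\<close> to fields. \<open>S\<close> is the class of related pairs along which it is
  considered, since a nonlocal characteristic need not make sense for all of them; \<open>S\<close> may be a
  single pair or consist of all related pairs.
\<close>

type_synonym 'n characteristic = "'n field \<Rightarrow> 'n field \<Rightarrow> 'n field"

definition SDYM3_symmetry :: "(complex \<times> complex \<times> complex) set \<Rightarrow>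
    ('n::finite field \<times> 'n field) set \<Rightarrow> 'n characteristic \<Rightarrow> bool" where
  "SDYM3_symmetry \<Omega> S Q \<longleftrightarrow>
     (\<forall>(J, X)\<in>S. holo \<Omega> (Q J X) \<and>
        (SDYM3_solution \<Omega> J \<longrightarrow> (\<forall>p\<in>\<Omega>. frechet J (Q J X) SDYM3 p = 0)))"

definition PSDYM3_symmetry :: "(complex \<times> complex \<times> complex) set \<Rightarrow>
    ('n::finite field \<times> 'n field) set \<Rightarrow> 'n characteristic \<Rightarrow> bool" where
  "PSDYM3_symmetry \<Omega> S \<Phi> \<longleftrightarrow>
     (\<forall>(J, X)\<in>S. holo \<Omega> (\<Phi> J X) \<and>
        (PSDYM3_solution \<Omega> X \<longrightarrow> (\<forall>p\<in>\<Omega>. frechet X (\<Phi> J X) PSDYM3 p = 0)))"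

end

theory Submission
  imports Defs
begin

text \<open>
  With \<open>Q = J \<Phi>\<close> one has \<open>\<Delta>(J\<inverse> J\<^sub>y) = \<Phi>\<^sub>y + [X\<^sub>z, \<Phi>]\<close> and \<open>\<Delta>(J\<inverse> J\<^sub>z) = \<Phi>\<^sub>z - [X\<^bsub>ybar\<^esub>, \<Phi>]\<close>.
  Taking \<open>D\<^bsub>ybar\<^esub>\<close> of the first and \<open>D\<^sub>z\<close> of the second, the terms containing \<open>X\<^bsub>z ybar\<^esub>\<close> cancel,
  and what is left is \<open>\<Delta>G[X]\<close> with \<open>\<Delta>X = \<Phi>\<close>. So \<open>\<Delta>F[J]\<close> and \<open>\<Delta>G[X]\<close> are the same function.
  That \<open>X\<close> solves the PSDYM3 equation is the compatibility condition \<open>J\<^bsub>yz\<^esub> = J\<^bsub>zy\<^esub>\<close>.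
\<close>

(* Otherwise A q $ i $ j also parses with the power series coefficient. *)
no_notation fps_nth (infixl "$" 75)

section \<open>Mixed partial derivatives in two complex variables\<close>

text \<open>Cauchy's inequality on discs of radius \<open>R / 4\<close> about points of the half
  ball bounds the second derivative by 2 M / (R / 4)^2 = 32 M / R^2. The constant depends only on
  \<open>M\<close> and \<open>R\<close>, so for a family of functions with a common bound the
  estimate is uniform.\<close>

lemma holomorphic_first_order_Taylor_bound:
  fixes G :: "complex \<Rightarrow> complex"
  assumes "G holomorphic_on ball t R" "\<And>x. x \<in> ball t R \<Longrightarrow> norm (G x) \<le> M"
    and "norm h < R / 2"
  shows "norm (G (t + h) - G t - h * deriv G t) \<le> 32 * M / R\<^sup>2 * (norm h)\<^sup>2"
proof -
  have R: "R > 0" using assms(3) norm_ge_zero[of h] by linarith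
  have sub: "cball x (R / 4) \<subseteq> ball t R" if "x \<in> ball t (R / 2)" for x
  proof
    fix y assume "y \<in> cball x (R/4)"
    then show "y \<in> ball t R" using that dist_triangle[of t y x] R by auto
  qed
  have G2: "norm ((deriv ^^ 2) G x) \<le> 32 * M / R\<^sup>2" if "x \<in> ball t (R / 2)" for x
  proof -
    have "norm ((deriv ^^ 2) G x) \<le> fact 2 * M / (R / 4) ^ 2"
    proof (rule Cauchy_inequality)
      show "G holomorphic_on ball x (R / 4)" "continuous_on (cball x (R / 4)) G"
        using sub[OF that] assms(1) ball_subset_cball
        by (meson holomorphic_on_subset order_trans,
            meson holomorphic_on_imp_continuous_on holomorphic_on_subset)
      show "norm (G y) \<le> M" if "norm (x - y) = R / 4" for y
        using sub[OF \<open>x \<in> ball t (R / 2)\<close>] that by (intro assms(2)) (auto simp: dist_norm)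
    qed (use R in auto)
    then show ?thesis by (simp add: power_divide)
  qed
  have "norm ((deriv ^^ 0) G (t + h) - (\<Sum>i\<le>1. (deriv ^^ i) G t * (t + h - t) ^ i / fact i))
      \<le> 32 * M / R\<^sup>2 * norm (t + h - t) ^ Suc 1 / fact 1"
  proof (rule complex_Taylor[where S = "ball t (R / 2)"])
    fix i x assume x: "x \<in> ball t (R / 2)"
    have "(deriv ^^ i) G holomorphic_on ball t R"
      using assms(1) by (rule holomorphic_higher_deriv) auto
    moreover have "x \<in> ball t R" using x R by auto
    ultimately show "((deriv ^^ i) G has_field_derivative (deriv ^^ Suc i) G x) (at x within ball t (R / 2))"
      by (auto intro: holomorphic_derivI has_field_derivative_at_within)
  qed (use G2 assms(3) R in \<open>auto simp: numeral_2_eq_2 dist_norm\<close>)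
  then show ?thesis by (simp add: power2_eq_square algebra_simps)
qed

text \<open>
  The difference quotients of \<open>g\<close> in \<open>t\<close> converge uniformly in \<open>s\<close> to \<open>\<partial>\<^sub>t g\<close>; by Weierstrass their
  \<open>s\<close>-derivatives converge as well. This gives both derivatives and their equality at once,
  without knowing beforehand that \<open>\<partial>\<^sub>t g\<close> is jointly regular.
\<close>

lemma separately_holomorphic_mixed_partials:
  fixes g :: "complex \<Rightarrow> complex \<Rightarrow> complex"
  assumes R: "R > 0"
    and hs: "\<And>t. t \<in> ball t0 R \<Longrightarrow> (\<lambda>s. g s t) holomorphic_on ball s0 R"
    and ht: "\<And>s. s \<in> ball s0 R \<Longrightarrow> g s holomorphic_on ball t0 R"
    and bd: "\<And>s t. s \<in> ball s0 R \<Longrightarrow> t \<in> ball t0 R \<Longrightarrow> norm (g s t) \<le> M"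
  shows "\<exists>d. ((\<lambda>s. deriv (g s) t0) has_field_derivative d) (at s0) \<and>
             ((\<lambda>t. deriv (\<lambda>s. g s t) s0) has_field_derivative d) (at t0)"
proof -
  define F where "F h s = (g s (t0 + h) - g s t0) / h" for h s
  define F' where "F' h s = (deriv (\<lambda>s. g s (t0 + h)) s - deriv (\<lambda>s. g s t0) s) / h" for h s
  define C where "C = 32 * M / R\<^sup>2"
  have sub: "cball s0 (R/2) \<subseteq> ball s0 R" using R by auto
  have near: "\<forall>\<^sub>F h in at 0. h \<noteq> 0 \<and> norm (h::complex) < R/2"
    using R by (auto simp: eventually_at intro!: exI[of _ "R/2"])
  have diff: "(F h has_field_derivative F' h s) (at s)" 
    if "s \<in> ball s0 R" "h \<noteq> 0" "norm h < R/2" for h s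
  proof -
    have "((\<lambda>s. g s (t0 + h)) has_field_derivative deriv (\<lambda>s. g s (t0 + h)) s) (at s)"
      by (rule holomorphic_derivI[OF hs open_ball]) (use that R in \<open>auto simp: dist_norm\<close>)
    moreover have "((\<lambda>s. g s t0) has_field_derivative deriv (\<lambda>s. g s t0) s) (at s)"
      by (rule holomorphic_derivI[OF hs open_ball]) (use that R in \<open>auto simp: dist_norm\<close>)
    ultimately show ?thesis unfolding F_def F'_def
      by (intro DERIV_cdivide DERIV_diff)
  qed
  have err: "dist (F h s) (deriv (g s) t0) \<le> C * norm h"
    if "s \<in> ball s0 R" "h \<noteq> 0" "norm h < R/2" for h s
  proof -
    have "norm (g s (t0 + h) - g s t0 - h * deriv (g s) t0) \<le> C * (norm h)\<^sup>2"
      unfolding C_def using that by (intro holomorphic_first_order_Taylor_bound ht bd)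
    moreover have "F h s - deriv (g s) t0 = (g s (t0 + h) - g s t0 - h * deriv (g s) t0) / h"
      using that by (simp add: F_def field_simps)
    ultimately show ?thesis using that
      by (simp add: dist_norm norm_divide divide_le_eq power2_eq_square mult.assoc)
  qed
  have lim: "uniform_limit (cball s0 (R/2)) F (\<lambda>s. deriv (g s) t0) (at 0)"
  proof (rule uniform_limitI)
    fix e :: real assume "e > 0"
    have "((\<lambda>h::complex. C * norm h) \<longlongrightarrow> C * norm (0::complex)) (at 0)"
      by (intro tendsto_intros)
    then have "\<forall>\<^sub>F h::complex in at 0. C * norm h < e"
      using \<open>e > 0\<close> by (intro order_tendstoD(2)) auto
    with near show "\<forall>\<^sub>F h in at 0. \<forall>s\<in>cball s0 (R/2). dist (F h s) (deriv (g s) t0) < e"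
      by eventually_elim (use err sub in force)
  qed
  have "\<forall>\<^sub>F h in at 0. continuous_on (cball s0 (R/2)) (F h) \<and>
      (\<forall>s\<in>ball s0 (R/2). (F h has_field_derivative F' h s) (at s))"
    using near
  proof eventually_elim
    case (elim h)
    then have "F h field_differentiable at s" if "s \<in> ball s0 R" for s
      using diff that field_differentiable_def by blast
    then have "continuous_on (ball s0 R) (F h)"
      by (simp add: continuous_at_imp_continuous_on field_differentiable_imp_continuous_at)
    with elim sub show ?case by (auto intro!: diff intro: continuous_on_subset)
  qed
  then obtain g' where g': "\<And>s. s \<in> ball s0 (R/2) \<Longrightarrow>
      ((\<lambda>s. deriv (g s) t0) has_field_derivative g' s) (at s) \<and> ((\<lambda>h. F' h s) \<longlongrightarrow> g' s) (at 0)"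
    by (rule has_complex_derivative_uniform_limit[OF _ lim]) (use R in auto)
  \<comment> \<open>\<open>F' h s0\<close> is itself the difference quotient in \<open>t\<close> of
    the partial derivative in \<open>s\<close> at \<open>s0\<close>, so its convergence is the
    second claim, with the same value \<open>g' s0\<close>.\<close>
  have "s0 \<in> ball s0 (R/2)" using R by simp
  from g'[OF this] show ?thesis
    by (auto simp: DERIV_def F'_def)
qed

section \<open>Slices parallel to the coordinate axes\<close>

primrec coordinate :: "coord \<Rightarrow> complex \<times> complex \<times> complex \<Rightarrow> complex" where
  "coordinate Y = (\<lambda>(y, z, w). y)"
| "coordinate Z = (\<lambda>(y, z, w). z)"
| "coordinate Ybar = (\<lambda>(y, z, w). w)"

primrec upd :: "coord \<Rightarrow> complex \<Rightarrow> complex \<times> complex \<times> complex \<Rightarrow> complex \<times> complex \<times> complex" where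
  "upd Y t = (\<lambda>(y, z, w). (t, z, w))"
| "upd Z t = (\<lambda>(y, z, w). (y, t, w))"
| "upd Ybar t = (\<lambda>(y, z, w). (y, z, t))"

text \<open>Merges the three clauses of \<open>pderiv3\<close> into one-variable calculus on a
  slice, so that later arguments run for a generic direction \<open>c\<close>.\<close>

lemma pderiv3_upd: "pderiv3 c f p = deriv (\<lambda>t. f (upd c t p)) (coordinate c p)"
  by (cases c; cases p) auto

lemma upd_coordinate [simp]: "upd c (coordinate c p) p = p"
  by (cases c; cases p) auto

lemma coordinate_upd [simp]: "coordinate c (upd c' t p) = (if c = c' then t else coordinate c p)"
  by (cases c; cases c'; cases p) auto

lemma upd_upd [simp]: "upd c s (upd c t p) = upd c s p"
  by (cases c; cases p) auto

lemma upd_commute: "c \<noteq> c' \<Longrightarrow> upd c s (upd c' t p) = upd c' t (upd c s p)"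
  by (cases c; cases c'; cases p) auto

lemma dist_upd: "dist (upd c t p) p = dist t (coordinate c p)"
  by (cases c; cases p) (auto simp: dist_Pair_Pair)

lemma dist_upd_upd:
  assumes "c \<noteq> c'"
  shows "dist (upd c s (upd c' t p)) p \<le> dist s (coordinate c p) + dist t (coordinate c' p)"
proof -
  have "dist (upd c s (upd c' t p)) p \<le> dist (upd c s (upd c' t p)) (upd c' t p) + dist (upd c' t p) p"
    by (rule dist_triangle)
  then show ?thesis using assms by (simp add: dist_upd)
qed

lemma eventually_upd:
  assumes "open \<Omega>" "p \<in> \<Omega>"
  shows "\<forall>\<^sub>F t in nhds (coordinate c p). upd c t p \<in> \<Omega>"
proof -
  obtain e where "e > 0" "ball p e \<subseteq> \<Omega>" using assms open_contains_ball by blast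
  then show ?thesis
    unfolding eventually_nhds_metric by (metis dist_commute dist_upd mem_ball subsetD)
qed

section \<open>Complex differentiability of entries, products and inverses\<close>

text \<open>\<open>has_derivative\<close> alone is real-linear; the prescribed form of the
  derivative makes it complex-linear. This is the scalar, pointwise content of \<open>holo\<close>,
  for which closure properties are easier to prove.\<close>

definition cdiff :: "(complex \<times> complex \<times> complex \<Rightarrow> complex) \<Rightarrow> complex \<times> complex \<times> complex \<Rightarrow> bool" where
  "cdiff f p \<longleftrightarrow> (\<exists>a b c. (f has_derivative (\<lambda>(h, k, l). a * h + b * k + c * l)) (at p))"

lemma holo_cdiff: "holo \<Omega> A \<longleftrightarrow> (\<forall>p\<in>\<Omega>. \<forall>i j. cdiff (\<lambda>q. A q $ i $ j) p)"
  by (simp add: holo_def cdiff_def)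

lemma cdiff_cong:
  assumes "open \<Omega>" "p \<in> \<Omega>" "\<And>q. q \<in> \<Omega> \<Longrightarrow> f q = g q" "cdiff g p"
  shows "cdiff f p"
  using assms unfolding cdiff_def
  by (metis (no_types, lifting) has_derivative_transform_within_open)

lemma cdiff_const: "cdiff (\<lambda>q. k) p"
  unfolding cdiff_def by (intro exI[of _ 0]) (auto simp: case_prod_unfold)

lemma cdiff_add:
  assumes "cdiff f p" "cdiff g p"
  shows "cdiff (\<lambda>q. f q + g q) p"
proof -
  obtain a b c where f: "(f has_derivative (\<lambda>(h, k, l). a * h + b * k + c * l)) (at p)"
    using assms(1) cdiff_def by blast
  obtain a' b' c' where g: "(g has_derivative (\<lambda>(h, k, l). a' * h + b' * k + c' * l)) (at p)"
    using assms(2) cdiff_def by blast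
  show ?thesis unfolding cdiff_def
    by (intro exI[of _ "a + a'"] exI[of _ "b + b'"] exI[of _ "c + c'"]
        has_derivative_eq_rhs[OF has_derivative_add[OF f g]])
      (auto simp: fun_eq_iff algebra_simps)
qed

lemma cdiff_mult:
  assumes "cdiff f p" "cdiff g p"
  shows "cdiff (\<lambda>q. f q * g q) p"
proof -
  obtain a b c where f: "(f has_derivative (\<lambda>(h, k, l). a * h + b * k + c * l)) (at p)"
    using assms(1) cdiff_def by blast
  obtain a' b' c' where g: "(g has_derivative (\<lambda>(h, k, l). a' * h + b' * k + c' * l)) (at p)"
    using assms(2) cdiff_def by blast
  show ?thesis unfolding cdiff_def
    by (intro exI[of _ "a * g p + f p * a'"] exI[of _ "b * g p + f p * b'"]
        exI[of _ "c * g p + f p * c'"] has_derivative_eq_rhs[OF has_derivative_mult[OF f g]])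
      (auto simp: fun_eq_iff algebra_simps)
qed

lemma cdiff_sum: "(\<And>i. i \<in> I \<Longrightarrow> cdiff (f i) p) \<Longrightarrow> cdiff (\<lambda>q. \<Sum>i\<in>I. f i q) p"
  by (induction I rule: infinite_finite_induct) (auto intro: cdiff_const cdiff_add)

lemma cdiff_prod: "(\<And>i. i \<in> I \<Longrightarrow> cdiff (f i) p) \<Longrightarrow> cdiff (\<lambda>q. \<Prod>i\<in>I. f i q) p"
  by (induction I rule: infinite_finite_induct) (auto intro: cdiff_const cdiff_mult)

lemma cdiff_det:
  assumes "\<And>i j. cdiff (\<lambda>q. A q $ i $ j) p"
  shows "cdiff (\<lambda>q. det (A q)) p"
  unfolding det_def by (intro cdiff_sum cdiff_mult cdiff_const cdiff_prod assms)

lemma holo_matrix_mult: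
  assumes "holo \<Omega> A" "holo \<Omega> B"
  shows "holo \<Omega> (\<lambda>p. A p ** B p)"
  using assms by (auto simp: holo_cdiff matrix_matrix_mult_def intro!: cdiff_sum cdiff_mult)

lemma matrix_inv_mult:
  fixes A :: "complex ^ 'n ^ 'n"
  assumes "det A \<noteq> 0"
  shows "matrix_inv A ** A = mat 1" "A ** matrix_inv A = mat 1"
proof -
  have "\<exists>A'. A ** A' = mat 1 \<and> A' ** A = mat 1"
    using assms invertible_det_nz invertible_def by blast
  then have "A ** matrix_inv A = mat 1 \<and> matrix_inv A ** A = mat 1"
    unfolding matrix_inv_def by (rule someI_ex)
  then show "matrix_inv A ** A = mat 1" "A ** matrix_inv A = mat 1" by auto
qed

text \<open>Cramer's rule for A x = e_j, whose solution is column \<open>j\<close> of the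
  inverse.\<close>

lemma matrix_inv_entry:
  fixes A :: "complex ^ 'n ^ 'n"
  assumes "det A \<noteq> 0"
  shows "matrix_inv A $ i $ j =
    det (\<chi> i' j'. if j' = i then axis j 1 $ i' else A $ i' $ j') / det A"
proof -
  have "A *v (matrix_inv A *v axis j 1) = axis j 1"
    using matrix_inv_mult(2)[OF assms] by (simp add: matrix_vector_mul_assoc)
  then have "matrix_inv A *v axis j 1 =
      (\<chi> k. det (\<chi> i' j'. if j' = k then axis j 1 $ i' else A $ i' $ j') / det A)"
    using cramer[OF assms] by blast
  moreover have "(matrix_inv A *v axis j 1) $ i = matrix_inv A $ i $ j"
    by (simp add: matrix_vector_mul_component inner_axis matrix_vector_mult_def axis_def if_distrib
        cong: if_cong)
  ultimately show ?thesis by simp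
qed

text \<open>Where the determinant is 1, Cramer's quotients reduce to their numerators, which are
  polynomials in the entries of \<open>J\<close>.\<close>

lemma holo_matrix_inv:
  assumes "open \<Omega>" "holo \<Omega> J" "\<And>p. p \<in> \<Omega> \<Longrightarrow> det (J p) = 1"
  shows "holo \<Omega> (\<lambda>p. matrix_inv (J p))"
  unfolding holo_cdiff
proof (intro ballI allI)
  fix p i j assume p: "p \<in> \<Omega>"
  show "cdiff (\<lambda>q. matrix_inv (J q) $ i $ j) p"
  proof (rule cdiff_cong[OF assms(1) p])
    show "matrix_inv (J q) $ i $ j =
        det (\<chi> i' j'. if j' = i then axis j 1 $ i' else J q $ i' $ j')" if "q \<in> \<Omega>" for q
      using matrix_inv_entry[of "J q"] assms(3)[OF that] by simp
    have "cdiff (\<lambda>q. if j' = i then axis j 1 $ i' else J q $ i' $ j') p" for i' j'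
      using assms(2) p by (cases "j' = i") (auto simp: holo_cdiff cdiff_const)
    then show "cdiff (\<lambda>q. det (\<chi> i' j'. if j' = i then axis j 1 $ i' else J q $ i' $ j')) p"
      by (intro cdiff_det) simp
  qed
qed

section \<open>First and second partial derivatives along slices\<close>

lemma cdiff_slice:
  assumes "cdiff f (upd c t p)"
  shows "(\<lambda>t. f (upd c t p)) field_differentiable at t"
proof -
  obtain y z w where p: "p = (y, z, w)" by (cases p)
  obtain a b d where f: "(f has_derivative (\<lambda>(h, k, l). a * h + b * k + d * l)) (at (upd c t p))"
    using assms cdiff_def by blast
  \<comment> \<open>The slice is affine in \<open>t\<close>, and \<open>upd c h 0\<close> is
    \<open>h\<close> times the unit vector in direction \<open>c\<close>.\<close>
  have "((\<lambda>t. upd c t p) has_derivative (\<lambda>h. upd c h 0)) (at t)"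
    by (cases c) (auto simp: p zero_prod_def intro!: derivative_eq_intros)
  from has_derivative_compose[OF this f]
  have "((\<lambda>t. f (upd c t p)) has_derivative (*) (case c of Y \<Rightarrow> a | Z \<Rightarrow> b | Ybar \<Rightarrow> d)) (at t)"
    by (rule has_derivative_eq_rhs) (cases c; auto simp: zero_prod_def)
  then show ?thesis
    unfolding field_differentiable_def has_field_derivative_def by blast
qed

text \<open>Restricts \<open>f\<close> to the plane through \<open>p\<close> in the two directions
  and applies the two-variable lemma there; continuity at \<open>p\<close> supplies the local
  bound.\<close>

lemma cdiff_mixed:
  assumes "open \<Omega>" "p \<in> \<Omega>" "\<And>q. q \<in> \<Omega> \<Longrightarrow> cdiff f q" "c \<noteq> c'"
  shows "\<exists>d. ((\<lambda>t. pderiv3 c' f (upd c t p)) has_field_derivative d) (at (coordinate c p)) \<and>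
             ((\<lambda>t. pderiv3 c f (upd c' t p)) has_field_derivative d) (at (coordinate c' p))"
proof -
  obtain e1 where e1: "e1 > 0" "ball p e1 \<subseteq> \<Omega>" using assms open_contains_ball by blast
  have "continuous (at p) f"
    using assms(2,3) has_derivative_continuous unfolding cdiff_def by blast
  then obtain e2 where e2: "e2 > 0" "\<And>q. dist q p < e2 \<Longrightarrow> dist (f q) (f p) < 1"
    unfolding continuous_at_eps_delta by (metis zero_less_one)
  \<comment> \<open>The halving pays for moving in two coordinates, since by
    \<open>dist_upd_upd\<close> the displacements add. \<open>e1\<close> keeps the points in
    \<open>\<Omega>\<close>; \<open>e2\<close> keeps the values within 1 of \<open>f p\<close>,
    whence the bound \<open>norm (f p) + 1\<close>.\<close>
  define R where "R = min e1 e2 / 2"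
  define g where "g s t = f (upd c s (upd c' t p))" for s t
  have R: "R > 0" using e1 e2 by (simp add: R_def)
  have near: "dist (upd c s (upd c' t p)) p < min e1 e2"
    if "s \<in> ball (coordinate c p) R" "t \<in> ball (coordinate c' p) R" for s t
    using dist_upd_upd[OF assms(4), of s t p] that by (simp add: R_def dist_commute)
  have in_dom: "upd c s (upd c' t p) \<in> \<Omega>"
    if "s \<in> ball (coordinate c p) R" "t \<in> ball (coordinate c' p) R" for s t
    using near[OF that] by (intro subsetD[OF e1(2)]) (simp add: dist_commute[of p])
  have "\<exists>d. ((\<lambda>s. deriv (g s) (coordinate c' p)) has_field_derivative d) (at (coordinate c p)) \<and>
      ((\<lambda>t. deriv (\<lambda>s. g s t) (coordinate c p)) has_field_derivative d) (at (coordinate c' p))"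
  proof (rule separately_holomorphic_mixed_partials[OF R])
    fix t assume t: "t \<in> ball (coordinate c' p) R"
    show "(\<lambda>s. g s t) holomorphic_on ball (coordinate c p) R"
      unfolding holomorphic_on_def g_def
      by (intro ballI field_differentiable_at_within[OF cdiff_slice] assms(3) in_dom t)
  next
    fix s assume s: "s \<in> ball (coordinate c p) R"
    show "g s holomorphic_on ball (coordinate c' p) R"
      unfolding holomorphic_on_def g_def upd_commute[OF assms(4)]
      by (intro ballI field_differentiable_at_within[OF cdiff_slice] assms(3)
          in_dom[unfolded upd_commute[OF assms(4)]] s)
  next
    fix s t assume "s \<in> ball (coordinate c p) R" "t \<in> ball (coordinate c' p) R"
    then have "dist (g s t) (f p) < 1" using near unfolding g_def by (intro e2) auto
    then show "norm (g s t) \<le> norm (f p) + 1"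
      using norm_triangle_ineq2[of "g s t" "f p"] by (simp add: dist_norm)
  qed
  then show ?thesis
    using assms(4) by (simp add: g_def[abs_def] pderiv3_upd upd_commute[OF assms(4)])
qed

text \<open>Complements \<open>cdiff_mixed\<close>, which covers distinct directions: on a single
  slice the derivative of a holomorphic function is again holomorphic.\<close>

lemma cdiff_repeated:
  assumes "open \<Omega>" "p \<in> \<Omega>" "\<And>q. q \<in> \<Omega> \<Longrightarrow> cdiff f q"
  shows "(\<lambda>t. pderiv3 c f (upd c t p)) field_differentiable at (coordinate c p)"
proof -
  obtain e where e: "e > 0" "ball p e \<subseteq> \<Omega>" using assms open_contains_ball by blast
  have "(\<lambda>t. f (upd c t p)) holomorphic_on ball (coordinate c p) e"
    unfolding holomorphic_on_def
    using e by (intro ballI field_differentiable_at_within[OF cdiff_slice] assms(3))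
      (metis dist_commute dist_upd mem_ball subsetD)
  then have "deriv (\<lambda>t. f (upd c t p)) holomorphic_on ball (coordinate c p) e"
    by (rule holomorphic_deriv) auto
  then show ?thesis
    using e by (auto simp: pderiv3_upd holomorphic_on_imp_differentiable_at)
qed

section \<open>Calculus of total derivatives of matrix fields\<close>

text \<open>\<open>D\<close> rests on \<open>deriv\<close>, which has some value even where no
  derivative exists. \<open>has_D\<close> includes existence, so sum and product rules compose
  without side conditions. It asks for differentiability along one slice only, which is what
  \<open>holo_D_mixed\<close> provides for first derivatives.\<close>

definition has_D :: "coord \<Rightarrow> 'n::finite field \<Rightarrow> complex ^ 'n ^ 'n \<Rightarrow> complex \<times> complex \<times> complex \<Rightarrow> bool" where
  "has_D c A A' p \<longleftrightarrow>
     (\<forall>i j. ((\<lambda>t. A (upd c t p) $ i $ j) has_field_derivative A' $ i $ j) (at (coordinate c p)))"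

lemma has_D_imp_D: "has_D c A A' p \<Longrightarrow> D c A p = A'"
  by (simp add: has_D_def D_def pderiv3_upd vec_eq_iff DERIV_imp_deriv)

lemma has_D_D:
  assumes "\<And>i j. (\<lambda>t. A (upd c t p) $ i $ j) field_differentiable at (coordinate c p)"
  shows "has_D c A (D c A p) p"
  using assms by (simp add: has_D_def D_def pderiv3_upd field_differentiable_derivI)

text \<open>Makes it possible to differentiate identities that hold only on \<open>\<Omega>\<close>:
  near a point of an open set, the slice through that point stays inside the set.\<close>

lemma has_D_cong:
  assumes "open \<Omega>" "p \<in> \<Omega>" "\<And>q. q \<in> \<Omega> \<Longrightarrow> A q = B q" "has_D c B B' p"
  shows "has_D c A B' p"
  unfolding has_D_def
proof (intro allI)
  fix i j
  have "\<forall>\<^sub>F t in nhds (coordinate c p). A (upd c t p) $ i $ j = B (upd c t p) $ i $ j"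
    using eventually_upd[OF assms(1,2)] by eventually_elim (simp add: assms(3))
  from DERIV_cong_ev[OF refl this refl]
  show "((\<lambda>t. A (upd c t p) $ i $ j) has_field_derivative B' $ i $ j) (at (coordinate c p))"
    using assms(4) unfolding has_D_def by blast
qed

lemma has_D_add:
  "has_D c A A' p \<Longrightarrow> has_D c B B' p \<Longrightarrow> has_D c (\<lambda>q. A q + B q) (A' + B') p"
  by (auto simp: has_D_def intro: DERIV_add)

lemma has_D_diff:
  "has_D c A A' p \<Longrightarrow> has_D c B B' p \<Longrightarrow> has_D c (\<lambda>q. A q - B q) (A' - B') p"
  by (auto simp: has_D_def intro: DERIV_diff)

lemma has_D_minus: "has_D c A A' p \<Longrightarrow> has_D c (\<lambda>q. - A q) (- A') p"
  by (auto simp: has_D_def intro: DERIV_minus)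

lemma has_D_mult:
  assumes "has_D c A A' p" "has_D c B B' p"
  shows "has_D c (\<lambda>q. A q ** B q) (A' ** B p + A p ** B') p"
  unfolding has_D_def
proof (intro allI)
  fix i j
  have "((\<lambda>t. \<Sum>k\<in>UNIV. A (upd c t p) $ i $ k * B (upd c t p) $ k $ j) has_field_derivative
      (\<Sum>k\<in>UNIV. A' $ i $ k * B p $ k $ j + B' $ k $ j * A p $ i $ k)) (at (coordinate c p))"
  proof (rule DERIV_sum)
    fix k
    have "((\<lambda>t. A (upd c t p) $ i $ k) has_field_derivative A' $ i $ k) (at (coordinate c p))"
      "((\<lambda>t. B (upd c t p) $ k $ j) has_field_derivative B' $ k $ j) (at (coordinate c p))"
      using assms by (auto simp: has_D_def)
    from DERIV_mult[OF this]
    show "((\<lambda>t. A (upd c t p) $ i $ k * B (upd c t p) $ k $ j) has_field_derivative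
        (A' $ i $ k * B p $ k $ j + B' $ k $ j * A p $ i $ k)) (at (coordinate c p))"
      by simp
  qed
  then show "((\<lambda>t. (A (upd c t p) ** B (upd c t p)) $ i $ j) has_field_derivative
      (A' ** B p + A p ** B') $ i $ j) (at (coordinate c p))"
    by (simp add: matrix_matrix_mult_def sum.distrib mult.commute)
qed

lemma holo_has_D:
  assumes "holo \<Omega> A" "p \<in> \<Omega>"
  shows "has_D c A (D c A p) p"
proof (rule has_D_D)
  fix i j
  have "cdiff (\<lambda>q. A q $ i $ j) (upd c (coordinate c p) p)"
    using assms by (simp add: holo_cdiff)
  then show "(\<lambda>t. A (upd c t p) $ i $ j) field_differentiable at (coordinate c p)"
    by (rule cdiff_slice)
qed

text \<open>Entrywise \<open>cdiff_repeated\<close> or \<open>cdiff_mixed\<close>. Existence comes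
  along with symmetry, so second derivatives can be formed without showing that
  \<open>D c' A\<close> is jointly holomorphic.\<close>

lemma holo_D_mixed:
  assumes "open \<Omega>" "holo \<Omega> A" "p \<in> \<Omega>"
  shows "has_D c (D c' A) (D c (D c' A) p) p" "D c (D c' A) p = D c' (D c A) p"
proof -
  have mixed: "\<exists>d. ((\<lambda>t. pderiv3 c' (\<lambda>q. A q $ i $ j) (upd c t p)) has_field_derivative d)
        (at (coordinate c p)) \<and>
      ((\<lambda>t. pderiv3 c (\<lambda>q. A q $ i $ j) (upd c' t p)) has_field_derivative d)
        (at (coordinate c' p))" for i j
  proof (cases "c = c'")
    case True
    have "(\<lambda>t. pderiv3 c (\<lambda>q. A q $ i $ j) (upd c t p)) field_differentiable at (coordinate c p)"
      using assms by (intro cdiff_repeated[OF assms(1)]) (auto simp: holo_cdiff)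
    then show ?thesis using True by (auto simp: field_differentiable_def)
  next
    case False
    then show ?thesis
      using assms by (intro cdiff_mixed[OF assms(1)]) (auto simp: holo_cdiff)
  qed
  then show "has_D c (D c' A) (D c (D c' A) p) p"
    by (intro has_D_D) (auto simp: D_def field_differentiable_def)
  show "D c (D c' A) p = D c' (D c A) p"
  proof -
    have "deriv (\<lambda>t. pderiv3 c' (\<lambda>q. A q $ i $ j) (upd c t p)) (coordinate c p) =
        deriv (\<lambda>t. pderiv3 c (\<lambda>q. A q $ i $ j) (upd c' t p)) (coordinate c' p)" for i j
      using mixed[of i j] by (metis DERIV_imp_deriv)
    then show ?thesis by (simp add: D_def pderiv3_upd[of c] pderiv3_upd[of c'] vec_eq_iff)
  qed
qed

text \<open>A normal form for noncommutative computation: products nest to the right, the shape in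
  which the later facts \<open>inv\<close> cancel \<open>J\<close> against its inverse. The rule for
  \<open>mat (- 1)\<close> resolves the \<open>Scale (- 1)\<close> in
  \<open>commutator\<close>.\<close>

lemma matrix_ring_simps:
  fixes A B C :: "complex ^ 'n::finite ^ 'n"
  shows "(A + B) ** C = A ** C + B ** C" "A ** (B + C) = A ** B + A ** C"
    "(A - B) ** C = A ** C - B ** C" "A ** (B - C) = A ** B - A ** C"
    "(- A) ** B = - (A ** B)" "A ** (- B) = - (A ** B)" "mat (- 1) ** A = - A"
    "(A ** B) ** C = A ** (B ** C)"
proof -
  show "mat (- 1) ** A = - A"
    by (simp add: vec_eq_iff matrix_matrix_mult_def mat_def if_distrib if_distribR cong: if_cong)
  show "(A ** B) ** C = A ** (B ** C)"
    by (simp add: matrix_mul_assoc)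
qed (simp_all add: vec_eq_iff matrix_matrix_mult_def sum.distrib sum_subtractf sum_negf
      ring_distribs)

section \<open>The potential and the linearised equations\<close>

text \<open>Left multiplication by \<open>J p\<close> clears the inverse, so that differentiating
  these relations again produces no derivative of an inverse.\<close>

lemma potential_D_J:
  assumes "SDYM3_solution \<Omega> J" "potential \<Omega> J X" "p \<in> \<Omega>"
  shows "D Y J p = J p ** D Z X p" "D Z J p = - (J p ** D Ybar X p)"
proof -
  have inv: "J p ** (matrix_inv (J p) ** A) = A" for A
    using assms(1,3) matrix_inv_mult(2)[of "J p"]
    by (simp add: SDYM3_solution_def matrix_mul_assoc)
  have "matrix_inv (J p) ** D Y J p = D Z X p" "matrix_inv (J p) ** D Z J p = - D Ybar X p"
    using assms(2,3) by (auto simp: potential_def)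
  then show "D Y J p = J p ** D Z X p" "D Z J p = - (J p ** D Ybar X p)"
    using inv[of "D Y J p"] inv[of "D Z J p"] by (auto simp: matrix_ring_simps)
qed

lemma potential_PSDYM3_solution:
  assumes "open \<Omega>" "SDYM3_solution \<Omega> J" "potential \<Omega> J X"
  shows "PSDYM3_solution \<Omega> X"
proof -
  have hJ: "holo \<Omega> J" and hX: "holo \<Omega> X"
    using assms by (auto simp: SDYM3_solution_def potential_def)
  have "eval X PSDYM3 p = 0" if p: "p \<in> \<Omega>" for p
  proof -
    note DJ = potential_D_J[OF assms(2,3)]
    note DX = holo_D_mixed(1)[OF assms(1) hX p]
    let ?G = "D Z (D Z X) p + D Y (D Ybar X) p + D Z X p ** D Ybar X p - D Ybar X p ** D Z X p"
    have "D Z (D Y J) p = D Z J p ** D Z X p + J p ** D Z (D Z X) p"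
      by (intro has_D_imp_D has_D_cong[OF assms(1) p DJ(1)] has_D_mult holo_has_D[OF hJ p] DX)
    moreover have "D Y (D Z J) p = - (D Y J p ** D Ybar X p + J p ** D Y (D Ybar X) p)"
      by (intro has_D_imp_D has_D_cong[OF assms(1) p DJ(2)] has_D_minus has_D_mult
          holo_has_D[OF hJ p] DX)
    moreover have "D Z (D Y J) p = D Y (D Z J) p"
      by (rule holo_D_mixed(2)[OF assms(1) hJ p])
    \<comment> \<open>Replacing first derivatives of \<open>J\<close> by \<open>DJ\<close> turns the
      equality of mixed derivatives into J G[X] = 0; the two products of first derivatives of
      \<open>X\<close> form the commutator.\<close>
    ultimately have "J p ** ?G = 0"
      by (simp add: DJ[OF p] matrix_ring_simps algebra_simps eq_neg_iff_add_eq_0)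
    then have "matrix_inv (J p) ** (J p ** ?G) = 0"
      by simp
    then have "?G = 0"
      using assms(2) p matrix_inv_mult(1)[of "J p"]
      by (simp add: SDYM3_solution_def matrix_mul_assoc)
    then show ?thesis
      by (simp add: eval_PSDYM3 holo_D_mixed(2)[OF assms(1) hX p, of Ybar Y] algebra_simps)
  qed
  then show ?thesis
    using assms(3) by (auto simp: PSDYM3_solution_def potential_def)
qed

text \<open>The linearisations agree pointwise rather than merely vanishing together, so one
  identity yields both directions of the theorem. \<open>Q\<close> and \<open>\<phi>\<close> are
  related on \<open>\<Omega>\<close> only, where \<open>J\<close> is known to be invertible; this
  admits \<phi> = J^{-1} Q.\<close>

lemma frechet_SDYM3_eq_frechet_PSDYM3:
  assumes "open \<Omega>" "SDYM3_solution \<Omega> J" "potential \<Omega> J X"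
    and "holo \<Omega> \<phi>" "\<And>q. q \<in> \<Omega> \<Longrightarrow> Q q = J q ** \<phi> q" "p \<in> \<Omega>"
  shows "frechet J Q SDYM3 p = frechet X \<phi> PSDYM3 p"
proof -
  have hJ: "holo \<Omega> J" and hX: "holo \<Omega> X"
    using assms by (auto simp: SDYM3_solution_def potential_def)
  note DJ = potential_D_J[OF assms(2,3)]
  have inv: "matrix_inv (J q) ** (J q ** A) = A" if "q \<in> \<Omega>" for q A
    using assms(2) that matrix_inv_mult(1)[of "J q"]
    by (simp add: SDYM3_solution_def matrix_mul_assoc)
  have DQ: "D c Q q = D c J q ** \<phi> q + J q ** D c \<phi> q" if "q \<in> \<Omega>" for c q
    by (intro has_D_imp_D has_D_cong[OF assms(1) that assms(5)] has_D_mult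
        holo_has_D[OF hJ that] holo_has_D[OF assms(4) that])
  have Dp: "has_D c \<phi> (D c \<phi> p) p" "has_D c (D c' \<phi>) (D c (D c' \<phi>) p) p"
    "has_D c (D c' X) (D c (D c' X) p) p" for c c'
    using holo_has_D holo_D_mixed(1) assms hX by blast+
  \<comment> \<open>\<open>\<Delta> c\<close> is the Frechet derivative of J^{-1} D_c J, written
    exactly as \<open>frechet\<close> unfolds it, so that \<open>SDYM3_def\<close> later exposes
    it.\<close>
  define \<Delta> where "\<Delta> c = (\<lambda>q. - (matrix_inv (J q) ** Q q ** matrix_inv (J q)) ** D c J q
      + matrix_inv (J q) ** D c Q q)" for c
  \<comment> \<open>Inserting Q = J \<phi> gives \<phi>_c + [J^{-1} J_c, \<phi>], where J^{-1} J_c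
    is X_z for \<open>Y\<close> and -X_ybar for \<open>Z\<close>.\<close>
  have \<Delta>Y: "\<Delta> Y q = D Y \<phi> q + (D Z X q ** \<phi> q - \<phi> q ** D Z X q)" if "q \<in> \<Omega>" for q
    using that by (simp add: \<Delta>_def DQ DJ assms(5) matrix_ring_simps inv)
  have \<Delta>Z: "\<Delta> Z q = D Z \<phi> q - (D Ybar X q ** \<phi> q - \<phi> q ** D Ybar X q)" if "q \<in> \<Omega>" for q
    using that by (simp add: \<Delta>_def DQ DJ assms(5) matrix_ring_simps inv)
  have DY: "D Ybar (\<Delta> Y) p = D Ybar (D Y \<phi>) p +
      ((D Ybar (D Z X) p ** \<phi> p + D Z X p ** D Ybar \<phi> p) -
       (D Ybar \<phi> p ** D Z X p + \<phi> p ** D Ybar (D Z X) p))"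
    by (intro has_D_imp_D has_D_cong[OF assms(1,6) \<Delta>Y] has_D_add has_D_diff has_D_mult Dp)
  have DZ: "D Z (\<Delta> Z) p = D Z (D Z \<phi>) p -
      ((D Z (D Ybar X) p ** \<phi> p + D Ybar X p ** D Z \<phi> p) -
       (D Z \<phi> p ** D Ybar X p + \<phi> p ** D Z (D Ybar X) p))"
    by (intro has_D_imp_D has_D_cong[OF assms(1,6) \<Delta>Z] has_D_diff has_D_mult Dp)
  have mixed: "D Z (D Ybar X) p = D Ybar (D Z X) p"
    by (rule holo_D_mixed(2)[OF assms(1) hX assms(6)])
  have "frechet J Q SDYM3 p = D Ybar (\<Delta> Y) p + D Z (\<Delta> Z) p"
    by (simp add: SDYM3_def \<Delta>_def)
  \<comment> \<open>Besides the second derivatives of \<open>\<phi>\<close>, what survives is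
    [X_z, \<phi>_ybar] - [X_ybar, \<phi>_z] = [X_z, \<phi>_ybar] + [\<phi>_z, X_ybar], the
    linearised commutator.\<close>
  then show ?thesis
    unfolding DY DZ mixed by (simp add: PSDYM3_def commutator_def matrix_ring_simps algebra_simps)
qed

theorem mainTheorem1:
  fixes \<Omega> :: "(complex \<times> complex \<times> complex) set"
    and S :: "('n::finite field \<times> 'n field) set"
  assumes "open \<Omega>"
    and "\<And>J X. (J, X) \<in> S \<Longrightarrow> SDYM3_solution \<Omega> J \<and> potential \<Omega> J X"
  shows "(\<forall>(J, X)\<in>S. PSDYM3_solution \<Omega> X) \<and>
    (\<forall>Q. SDYM3_symmetry \<Omega> S Q \<longrightarrow>
       PSDYM3_symmetry \<Omega> S (\<lambda>J X p. matrix_inv (J p) ** Q J X p)) \<and>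
    (\<forall>\<Phi>. PSDYM3_symmetry \<Omega> S \<Phi> \<longrightarrow>
       SDYM3_symmetry \<Omega> S (\<lambda>J X p. J p ** \<Phi> J X p))"
proof (intro conjI allI impI)
  show sol: "\<forall>(J, X)\<in>S. PSDYM3_solution \<Omega> X"
    using assms potential_PSDYM3_solution by blast
  show "PSDYM3_symmetry \<Omega> S (\<lambda>J X p. matrix_inv (J p) ** Q J X p)"
    if Q: "SDYM3_symmetry \<Omega> S Q" for Q
    unfolding PSDYM3_symmetry_def
  proof clarify
    fix J X assume "(J, X) \<in> S"
    then have J: "SDYM3_solution \<Omega> J" and X: "potential \<Omega> J X" and hQ: "holo \<Omega> (Q J X)"
      and fQ: "\<And>p. p \<in> \<Omega> \<Longrightarrow> frechet J (Q J X) SDYM3 p = 0"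
      using assms(2) Q by (auto simp: SDYM3_symmetry_def)
    have det: "det (J p) = 1" if "p \<in> \<Omega>" for p
      using J that by (simp add: SDYM3_solution_def)
    have h: "holo \<Omega> (\<lambda>p. matrix_inv (J p) ** Q J X p)"
      using J by (intro holo_matrix_mult holo_matrix_inv assms(1) det hQ)
        (simp_all add: SDYM3_solution_def)
    have QJ: "Q J X p = J p ** (matrix_inv (J p) ** Q J X p)" if "p \<in> \<Omega>" for p
      using det[OF that] by (simp add: matrix_mul_assoc matrix_inv_mult(2))
    have "frechet X (\<lambda>p. matrix_inv (J p) ** Q J X p) PSDYM3 p = 0" if "p \<in> \<Omega>" for p
      using frechet_SDYM3_eq_frechet_PSDYM3[OF assms(1) J X h QJ that] fQ[OF that] by simp
    with h show "holo \<Omega> (\<lambda>p. matrix_inv (J p) ** Q J X p) \<and> (PSDYM3_solution \<Omega> X \<longrightarrow>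
        (\<forall>p\<in>\<Omega>. frechet X (\<lambda>p. matrix_inv (J p) ** Q J X p) PSDYM3 p = 0))"
      by blast
  qed
  show "SDYM3_symmetry \<Omega> S (\<lambda>J X p. J p ** \<Phi> J X p)" if \<Phi>: "PSDYM3_symmetry \<Omega> S \<Phi>" for \<Phi>
    unfolding SDYM3_symmetry_def
  proof clarify
    fix J X assume JX: "(J, X) \<in> S"
    \<comment> \<open>\<open>PSDYM3_symmetry\<close> constrains \<open>\<Phi>\<close> only along
      solutions \<open>X\<close>; \<open>sol\<close> discharges that premise.\<close>
    then have J: "SDYM3_solution \<Omega> J" and X: "potential \<Omega> J X" and h\<Phi>: "holo \<Omega> (\<Phi> J X)"
      and f\<Phi>: "\<And>p. p \<in> \<Omega> \<Longrightarrow> frechet X (\<Phi> J X) PSDYM3 p = 0"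
      using assms(2) \<Phi> sol by (auto simp: PSDYM3_symmetry_def)
    have "holo \<Omega> (\<lambda>p. J p ** \<Phi> J X p)"
      using J h\<Phi> by (intro holo_matrix_mult) (simp_all add: SDYM3_solution_def)
    moreover have "frechet J (\<lambda>p. J p ** \<Phi> J X p) SDYM3 p = 0" if "p \<in> \<Omega>" for p
      using frechet_SDYM3_eq_frechet_PSDYM3[OF assms(1) J X h\<Phi> refl that] f\<Phi>[OF that] by simp
    ultimately show "holo \<Omega> (\<lambda>p. J p ** \<Phi> J X p) \<and> (SDYM3_solution \<Omega> J \<longrightarrow>
        (\<forall>p\<in>\<Omega>. frechet J (\<lambda>p. J p ** \<Phi> J X p) SDYM3 p = 0))"
      by blast
  qed
qed

end
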